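(* Let $m \geq 1$ be an integer. Then $Z(C^H_{m,4}) = (-1)^{m+1} F_{m+2}$.
   Context: For integers $m \geq 0$, $n \geq 1$, $C^H_{m,n}$ is the hexagonal-grid cylinder with $m$ rows of $n$ hexagons each, drawn as a brick wall: its vertex set is $\{1,\dots,m+1\}\times\{1,\dots,2n\}$; distinct vertices $(i,j)$ and $(i,j')$ in the same row are adjacent iff $j - j' \equiv \pm 1 \pmod{2n}$ (so a row is a $2n$-cycle, or a single edge if $n=1$); and $(i,j)$, $(i+1,j)$ are adjacent iff $(i+1)+j$ is even; there are no other edges. For a finite simple graph $G$, $Z(G) = \sum_{\sigma} (-1)^{|\sigma|}$, the sum being over all independent sets $\sigma$ of $G$ (including $\emptyset$). The Fibonacci numbers are $F_0=0$, $F_1=1$, $F_{i+2}=F_{i+1}+F_i$ for $i\ge 0$. *)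

theory Defs
  imports
    "Graph_Theory.Pair_Digraph"
    "HOL-Number_Theory.Cong"
    "HOL-Number_Theory.Fib"
begin

text \<open>Finite simple graphs are the instances of the locale \<open>pair_graph\<close>; an edge is
  represented by its two arcs.\<close>

definition independent_sets :: "'a pair_pre_digraph \<Rightarrow> 'a set set" where
  "independent_sets G = {\<sigma>. \<sigma> \<subseteq> pverts G \<and> (\<forall>u\<in>\<sigma>. \<forall>v\<in>\<sigma>. (u, v) \<notin> parcs G)}"

definition Z :: "'a pair_pre_digraph \<Rightarrow> int" where
  "Z G = (\<Sum>\<sigma>\<in>independent_sets G. (-1) ^ card \<sigma>)"

definition hex_cylinder_verts :: "nat \<Rightarrow> nat \<Rightarrow> (nat \<times> nat) set" where
  "hex_cylinder_verts m n = {1..m + 1} \<times> {1..2 * n}"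

text \<open>The congruence is over \<open>int\<close>, since column indices are subtracted.\<close>

definition hex_row_adj :: "nat \<Rightarrow> nat \<times> nat \<Rightarrow> nat \<times> nat \<Rightarrow> bool" where
  "hex_row_adj n = (\<lambda>(i, j) (i', j'). i = i' \<and> j \<noteq> j' \<and>
     ([int j - int j' = 1] (mod int (2 * n)) \<or> [int j - int j' = -1] (mod int (2 * n))))"

text \<open>Oriented from row \<open>i\<close> to row \<open>i + 1\<close>; symmetrised in \<open>hex_cylinder\<close>.\<close>

definition hex_vertical :: "nat \<times> nat \<Rightarrow> nat \<times> nat \<Rightarrow> bool" where
  "hex_vertical = (\<lambda>(i, j) (i', j'). i' = i + 1 \<and> j' = j \<and> even ((i + 1) + j))"

definition hex_cylinder :: "nat \<Rightarrow> nat \<Rightarrow> (nat \<times> nat) pair_pre_digraph" where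
  "hex_cylinder m n =
     \<lparr> pverts = hex_cylinder_verts m n,
       parcs = {(u, v). u \<in> hex_cylinder_verts m n \<and> v \<in> hex_cylinder_verts m n \<and>
                  (hex_row_adj n u v \<or> hex_vertical u v \<or> hex_vertical v u)} \<rparr>"

lemma hex_row_adj_sym: "hex_row_adj n u v \<Longrightarrow> hex_row_adj n v u"
proof -
  have "[a - b = c] (mod k) \<Longrightarrow> [b - a = - c] (mod k)" for a b c k :: int
    using cong_minus_minus_iff[of "a - b" c k] by simp
  from this[of "int (snd u)" "int (snd v)" 1] this[of "int (snd u)" "int (snd v)" "-1"]
  show "hex_row_adj n u v \<Longrightarrow> hex_row_adj n v u"
    by (auto simp: hex_row_adj_def split: prod.splits)
qed

lemma pair_graph_hex_cylinder: "pair_graph (hex_cylinder m n)"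
proof
  have "parcs (hex_cylinder m n) \<subseteq> hex_cylinder_verts m n \<times> hex_cylinder_verts m n"
    by (auto simp: hex_cylinder_def)
  moreover have "finite (hex_cylinder_verts m n)"
    by (simp add: hex_cylinder_verts_def)
  ultimately show "finite (parcs (hex_cylinder m n))"
    using finite_subset by blast
  show "finite (pverts (hex_cylinder m n))"
    by (simp add: hex_cylinder_def hex_cylinder_verts_def)
  show "symmetric (hex_cylinder m n)"
    by (auto simp: symmetric_def hex_cylinder_def intro!: symI dest: hex_row_adj_sym)
qed (auto simp: hex_cylinder_def hex_row_adj_def hex_vertical_def split: prod.splits)

end

theory Submission
  imports Defs
begin

text \<open>
  The alternating sum collapses under a transfer-matrix argument in which half of every row has been
  summed out. In each row the columns alternate between those joined to the row above and those joined
  to the row below. In the top row the latter form an independent set \<open>B\<close>; once the rest \<open>\<sigma>\<close> of an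
  independent set is fixed, the vertices of \<open>B\<close> without a neighbour in \<open>\<sigma>\<close> may be added freely, and
  the signs cancel unless there are none (\<open>sum_out_independent_set\<close>). Hence only those \<open>\<sigma>\<close> count in
  which every vertex of \<open>B\<close> is dominated, either by a chosen vertex of its own row or by the vertex
  below it. So if \<open>U\<close> is what \<open>\<sigma>\<close> takes from the top row, the row below has to contain at least the
  columns that \<open>U\<close> leaves uncovered. Writing \<open>h\<^sub>m S\<close> for the signed sum over the independent sets
  whose top row contains \<open>S\<close> (\<open>top_sum\<close>), this reads
  \<open>h\<^sub>m\<^sub>+\<^sub>1 S = (\<Sum>U \<supseteq> S. (-1) ^ card U * h\<^sub>m (uncovered U))\<close> (\<open>top_sum_Suc\<close>).

  For circumference 8 there are four joining columns in each row, in cyclic order. The empty \<open>U\<close>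
  leaves all four columns of the row below uncovered, a single column leaves two consecutive ones, two
  consecutive columns leave one, and every other \<open>U\<close> leaves none. Let \<open>h\<^sub>m\<close> take the value \<open>e\<close> on the
  empty set, \<open>q\<close> on the full set, and one common value \<open>c\<close> on singletons and on consecutive pairs.
  In the sum for \<open>S = {}\<close> the four singletons cancel the four consecutive pairs, and the remaining
  signs give \<open>q - e\<close>; for \<open>S\<close> a singleton or a consecutive pair the sum is \<open>c - e\<close>, and for the full
  set it is \<open>e\<close>. So the shape persists (\<open>profile_transfer\<close>), and \<open>(e, q)\<close> becomes \<open>(q - e, e)\<close>, which
  is the Fibonacci recursion with alternating sign, starting from \<open>(-1, 1)\<close>.
\<close>

section \<open>Summing out an independent set of vertices\<close>

lemma sum_alternating_Pow:
  assumes "finite A"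
  shows "(\<Sum>D\<in>Pow A. (-1) ^ card D) = (of_bool (A = {}) :: int)"
proof -
  have "(\<Sum>D\<in>Pow A. (-1) ^ card D :: int) = 0 ^ card A"
    using prod_diff_conv_sum[of A "\<lambda>_. 1 :: int" "\<lambda>_. 1"] assms by simp
  then show ?thesis using assms by (simp add: power_0_left)
qed

lemma finite_independent_sets: "finite (pverts G) \<Longrightarrow> finite (independent_sets G)"
  by (rule finite_subset[of _ "Pow (pverts G)"]) (auto simp: independent_sets_def)

lemma parcs_symmetric:
  assumes "pair_graph G" "(u, v) \<in> parcs G"
  shows "(v, u) \<in> parcs G"
proof -
  interpret pair_graph G by fact
  show ?thesis using assms(2) arcs_symmetric by blast
qed

text \<open>Split an independent set into its part \<open>\<sigma>\<close> outside \<open>B\<close> and its part \<open>D\<close> inside. Since \<open>B\<close> is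
  independent, \<open>D\<close> ranges over all subsets of the set of vertices of \<open>B\<close> that have no neighbour in \<open>\<sigma>\<close>,
  and the signs of these subsets cancel unless that set is empty. The set \<open>T\<close> carries along a condition
  that does not interfere with the choice of \<open>D\<close>.\<close>

lemma sum_out_independent_set:
  assumes G: "pair_graph G" and B: "B \<in> independent_sets G" and T: "T \<inter> B = {}"
  shows "(\<Sum>\<sigma> | \<sigma> \<in> independent_sets G \<and> T \<subseteq> \<sigma>. (-1) ^ card \<sigma> :: int)
       = (\<Sum>\<sigma> | \<sigma> \<in> independent_sets G \<and> T \<subseteq> \<sigma> \<and> \<sigma> \<inter> B = {} \<and>
                (\<forall>b\<in>B. \<exists>u\<in>\<sigma>. (u, b) \<in> parcs G). (-1) ^ card \<sigma>)"
proof -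
  interpret pair_graph G by fact
  define A where "A = {\<sigma> \<in> independent_sets G. T \<subseteq> \<sigma> \<and> \<sigma> \<inter> B = {}}"
  \<comment> \<open>the vertices of \<open>B\<close> that are free to be added to \<open>\<sigma>\<close>\<close>
  define F where "F \<sigma> = {b \<in> B. \<forall>u\<in>\<sigma>. (u, b) \<notin> parcs G}" for \<sigma>
  have fin: "finite \<sigma>" if "\<sigma> \<in> independent_sets G" for \<sigma>
    using that by (auto simp: independent_sets_def intro: finite_subset)
  have finA: "finite A"
    using finite_independent_sets[of G] by (auto simp: A_def intro: finite_subset)
  have finF: "finite (F \<sigma>)" for \<sigma> using fin[OF B] by (simp add: F_def)
  have sym: "(u, v) \<in> parcs G \<longleftrightarrow> (v, u) \<in> parcs G" for u v
    using parcs_symmetric[OF G] by blast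
  have "(\<Sum>\<sigma> | \<sigma> \<in> independent_sets G \<and> T \<subseteq> \<sigma>. (-1) ^ card \<sigma> :: int)
      = (\<Sum>(\<sigma>, D) \<in> (SIGMA \<sigma>:A. Pow (F \<sigma>)). (-1) ^ card \<sigma> * (-1) ^ card D)"
  proof (rule sum.reindex_bij_witness[where i = "\<lambda>(\<sigma>, D). \<sigma> \<union> D" and j = "\<lambda>\<sigma>. (\<sigma> - B, \<sigma> \<inter> B)"])
    fix \<sigma> assume s: "\<sigma> \<in> {\<sigma>. \<sigma> \<in> independent_sets G \<and> T \<subseteq> \<sigma>}"
    show "(\<sigma> - B, \<sigma> \<inter> B) \<in> (SIGMA \<sigma>:A. Pow (F \<sigma>))"
      using s T by (auto simp: A_def F_def independent_sets_def)
    have "card \<sigma> = card (\<sigma> - B) + card (\<sigma> \<inter> B)"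
      using s fin by (subst card_Un_disjoint[symmetric]) (auto intro!: arg_cong[where f = card])
    then show "(case (\<sigma> - B, \<sigma> \<inter> B) of (\<sigma>, D) \<Rightarrow> (-1) ^ card \<sigma> * (-1) ^ card D) = ((-1) ^ card \<sigma> :: int)"
      by (simp add: power_add)
  next
    fix p assume p: "p \<in> (SIGMA \<sigma>:A. Pow (F \<sigma>))"
    obtain \<sigma> D where [simp]: "p = (\<sigma>, D)" by (cases p)
    have D: "D \<subseteq> B" using p by (auto simp: F_def)
    show "(case p of (\<sigma>, D) \<Rightarrow> \<sigma> \<union> D) \<in> {\<sigma>. \<sigma> \<in> independent_sets G \<and> T \<subseteq> \<sigma>}"
      using p B D sym unfolding A_def F_def independent_sets_def by (auto 0 3)
    show "((case p of (\<sigma>, D) \<Rightarrow> \<sigma> \<union> D) - B, (case p of (\<sigma>, D) \<Rightarrow> \<sigma> \<union> D) \<inter> B) = p"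
      using p D by (auto simp: A_def)
  qed auto
  also have "\<dots> = (\<Sum>\<sigma>\<in>A. (-1) ^ card \<sigma> * (\<Sum>D\<in>Pow (F \<sigma>). (-1) ^ card D))"
    using finA finF by (simp add: sum.Sigma sum_distrib_left)
  also have "\<dots> = (\<Sum>\<sigma>\<in>A. if F \<sigma> = {} then (-1) ^ card \<sigma> else 0)"
    by (intro sum.cong) (auto simp: sum_alternating_Pow[OF finF])
  also have "\<dots> = (\<Sum>\<sigma>\<in>{\<sigma>\<in>A. F \<sigma> = {}}. (-1) ^ card \<sigma>)"
    using finA by (subst sum.inter_filter) auto
  also have "{\<sigma>\<in>A. F \<sigma> = {}} = {\<sigma>. \<sigma> \<in> independent_sets G \<and> T \<subseteq> \<sigma> \<and> \<sigma> \<inter> B = {} \<and>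
                (\<forall>b\<in>B. \<exists>u\<in>\<sigma>. (u, b) \<in> parcs G)}"
    by (auto simp: A_def F_def)
  finally show ?thesis .
qed

section \<open>The transfer operator of the hexagonal cylinder\<close>

text \<open>The columns of the vertical edges between rows \<open>m + 1\<close> and \<open>m + 2\<close>. Row \<open>m + 1\<close> is the top row
  of \<open>hex_cylinder m n\<close>, so these are the columns at which the next row will be attached, while
  \<open>rungs n (m + 1)\<close> are the other columns of the top row, which lead downwards.\<close>

definition rungs :: "nat \<Rightarrow> nat \<Rightarrow> nat set" where
  "rungs n m = {j \<in> {1..2 * n}. even (m + j)}"

text \<open>The downward columns of the top row of \<open>hex_cylinder m n\<close> that the chosen upward columns \<open>U\<close> do
  not dominate within that row.\<close>

definition uncovered :: "nat \<Rightarrow> nat \<Rightarrow> nat set \<Rightarrow> nat set" where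
  "uncovered n m U = {j \<in> rungs n (m + 1). \<forall>u\<in>U. \<not> hex_row_adj n (0, u) (0, j)}"

definition top_sum :: "nat \<Rightarrow> nat \<Rightarrow> nat set \<Rightarrow> int" where
  "top_sum n m S = (\<Sum>\<sigma> | \<sigma> \<in> independent_sets (hex_cylinder m n) \<and> {m + 1} \<times> S \<subseteq> \<sigma>. (-1) ^ card \<sigma>)"

lemma independent_sets_hex_cylinder_subset:
  "\<sigma> \<in> independent_sets (hex_cylinder m n) \<Longrightarrow> \<sigma> \<subseteq> {1..m + 1} \<times> {1..2 * n}"
  by (simp add: independent_sets_def hex_cylinder_def hex_cylinder_verts_def)

lemma rungs_Suc_Suc: "rungs n (Suc (Suc m)) = rungs n m"
  by (simp add: rungs_def)

lemma finite_rungs: "finite (rungs n m)"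
  by (simp add: rungs_def)

text \<open>The row cycle has even length, so it is bipartite with the parity of the column as colouring.
  This is why the upward, and likewise the downward, vertices of a row are independent.\<close>

lemma hex_row_adj_opposite_parity:
  assumes "hex_row_adj n (i, j) (i', j')"
  shows "even j \<longleftrightarrow> odd j'"
proof -
  have "odd (int j - int j')" if "[int j - int j' = c] (mod int (2 * n))" "odd c" for c
  proof -
    have "(2::int) dvd int (2 * n)" by simp
    then have "[int j - int j' = c] (mod 2)" using that(1) cong_dvd_modulus by blast
    then show ?thesis using that(2) by (simp add: cong_def even_iff_mod_2_eq_zero)
  qed
  from this[of 1] this[of "-1"] assms show ?thesis
    by (auto simp: hex_row_adj_def)
qed

lemma hex_row_adj_shift: "hex_row_adj n (i, j) (i, j') \<longleftrightarrow> hex_row_adj n (0, j) (0, j')"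
  by (simp add: hex_row_adj_def)

text \<open>The set summed out consists of the downward vertices of the top row.\<close>

lemma top_sum_dominating:
  assumes S: "S \<subseteq> rungs n m"
  shows "top_sum n m S = (\<Sum>\<sigma> | \<sigma> \<in> independent_sets (hex_cylinder m n) \<and> {m + 1} \<times> S \<subseteq> \<sigma> \<and>
      \<sigma> \<inter> {m + 1} \<times> rungs n (m + 1) = {} \<and>
      (\<forall>b\<in>{m + 1} \<times> rungs n (m + 1). \<exists>u\<in>\<sigma>. (u, b) \<in> parcs (hex_cylinder m n)). (-1) ^ card \<sigma>)"
  unfolding top_sum_def
proof (rule sum_out_independent_set[OF pair_graph_hex_cylinder])
  show "{m + 1} \<times> rungs n (m + 1) \<in> independent_sets (hex_cylinder m n)"
    by (auto simp: independent_sets_def hex_cylinder_def hex_cylinder_verts_def rungs_def hex_vertical_def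
        dest: hex_row_adj_opposite_parity)
  show "{m + 1} \<times> S \<inter> {m + 1} \<times> rungs n (m + 1) = {}"
    using S by (auto simp: rungs_def)
qed

text \<open>Adds one row on top. In use, \<open>h\<close> is evaluated at the set of columns of the row below that have
  to be occupied because \<open>U\<close> leaves their upper neighbours undominated.\<close>

definition transfer :: "nat \<Rightarrow> nat \<Rightarrow> (nat set \<Rightarrow> int) \<Rightarrow> nat set \<Rightarrow> int" where
  "transfer n m h S = (\<Sum>U | S \<subseteq> U \<and> U \<subseteq> rungs n m. (-1) ^ card U * h (uncovered n m U))"

text \<open>With no row below, every downward vertex has to be dominated within the row; this is the transfer
  from a fictitious row in which only the empty set of columns is occupied.\<close>

lemma top_sum_0:
  assumes S: "S \<subseteq> rungs n 0"
  shows "top_sum n 0 S = transfer n 0 (\<lambda>V. of_bool (V = {})) S"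
proof -
  have "top_sum n 0 S = (\<Sum>U | S \<subseteq> U \<and> U \<subseteq> rungs n 0 \<and> uncovered n 0 U = {}. (-1) ^ card U)"
    unfolding top_sum_dominating[OF S]
  proof (rule sum.reindex_bij_witness[where i = "\<lambda>U. {1} \<times> U" and j = "\<lambda>\<sigma>. snd ` \<sigma>"], goal_cases)
    case (1 \<sigma>)
    then have "\<sigma> \<in> independent_sets (hex_cylinder 0 n)" by simp
    then have "\<sigma> \<subseteq> {1} \<times> {1..2 * n}"
      using independent_sets_hex_cylinder_subset[of \<sigma> 0 n] by simp
    then show ?case by force
  next
    case (2 \<sigma>)
    then have ind: "\<sigma> \<in> independent_sets (hex_cylinder 0 n)"
      and S': "{1} \<times> S \<subseteq> \<sigma>"
      and B: "\<sigma> \<inter> {1} \<times> rungs n 1 = {}"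
      and dom: "\<And>j. j \<in> rungs n 1 \<Longrightarrow> \<exists>u\<in>\<sigma>. (u, (1, j)) \<in> parcs (hex_cylinder 0 n)"
      by auto
    from ind have sub: "\<sigma> \<subseteq> {1} \<times> {1..2 * n}"
      using independent_sets_hex_cylinder_subset[of \<sigma> 0 n] by simp
    have "j \<notin> uncovered n 0 (snd ` \<sigma>)" for j
    proof
      assume j: "j \<in> uncovered n 0 (snd ` \<sigma>)"
      then obtain u where u: "u \<in> \<sigma>" "(u, (1, j)) \<in> parcs (hex_cylinder 0 n)"
        using dom[of j] by (auto simp: uncovered_def)
      obtain k where "u = (1, k)" using u(1) sub by auto
      with u have "hex_row_adj n (0, k) (0, j)"
        using hex_row_adj_shift[of n 1 k j] by (auto simp: hex_cylinder_def hex_vertical_def)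
      moreover have "k \<in> snd ` \<sigma>" using u(1) \<open>u = (1, k)\<close> by force
      ultimately show False using j by (auto simp: uncovered_def)
    qed
    moreover have "S \<subseteq> snd ` \<sigma>" using S' by force
    moreover have "snd ` \<sigma> \<subseteq> rungs n 0" using sub B by (fastforce simp: rungs_def)
    ultimately show ?case by blast
  next
    case (3 U)
    then show ?case by force
  next
    case (4 U)
    then have U: "S \<subseteq> U" "U \<subseteq> rungs n 0" "uncovered n 0 U = {}" by auto
    have "\<not> hex_row_adj n (1, k) (1, j)" if "k \<in> U" "j \<in> U" for k j
      using that U(2) hex_row_adj_opposite_parity[of n 1 k 1 j] by (auto simp: rungs_def)
    then have "{1} \<times> U \<in> independent_sets (hex_cylinder 0 n)"
      using U(2) by (auto simp: independent_sets_def hex_cylinder_def hex_cylinder_verts_def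
          rungs_def hex_vertical_def)
    moreover have "\<exists>u\<in>{1} \<times> U. (u, (1, j)) \<in> parcs (hex_cylinder 0 n)" if j: "j \<in> rungs n 1" for j
    proof -
      obtain u where u: "u \<in> U" "hex_row_adj n (0, u) (0, j)"
        using j U(3) by (auto simp: uncovered_def)
      then have "((1, u), (1, j)) \<in> parcs (hex_cylinder 0 n)"
        using j U(2) hex_row_adj_shift[of n 1 u j]
        by (auto simp: rungs_def hex_cylinder_def hex_cylinder_verts_def)
      with u(1) show ?thesis by blast
    qed
    moreover have "{1} \<times> U \<inter> {1} \<times> rungs n 1 = {}" using U(2) by (auto simp: rungs_def)
    ultimately show ?case using U(1) by auto
  next
    case (5 \<sigma>)
    then have "\<sigma> \<in> independent_sets (hex_cylinder 0 n)" by simp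
    then have "\<sigma> \<subseteq> {1} \<times> {1..2 * n}"
      using independent_sets_hex_cylinder_subset[of \<sigma> 0 n] by simp
    moreover have "inj_on snd ({1 :: nat} \<times> {1..2 * n})" by (auto simp: inj_on_def)
    ultimately have "inj_on snd \<sigma>" by (rule inj_on_subset[rotated])
    then show ?case by (simp add: card_image)
  qed
  also have "\<dots> = (\<Sum>U\<in>{U\<in>{U. S \<subseteq> U \<and> U \<subseteq> rungs n 0}. uncovered n 0 U = {}}. (-1) ^ card U)"
    by (rule sum.cong) auto
  also have "\<dots> = (\<Sum>U | S \<subseteq> U \<and> U \<subseteq> rungs n 0. if uncovered n 0 U = {} then (-1) ^ card U else 0)"
    by (rule sum.inter_filter) (rule finite_subset[of _ "Pow (rungs n 0)"], auto simp: finite_rungs)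
  also have "\<dots> = transfer n 0 (\<lambda>V. of_bool (V = {})) S"
    unfolding transfer_def by (rule sum.cong) auto
  finally show ?thesis .
qed

text \<open>A surviving independent set takes from the top row a set \<open>U\<close> of upward columns, whose only
  neighbours are summed-out vertices; hence \<open>U\<close> and the part \<open>\<sigma>\<close> in the lower rows can be combined
  without regard to independence. The one link between them is that \<open>\<sigma>\<close> must dominate from below what
  \<open>U\<close> leaves uncovered.\<close>

lemma top_sum_Suc:
  assumes S: "S \<subseteq> rungs n (Suc m)"
  shows "top_sum n (Suc m) S = transfer n (Suc m) (top_sum n m) S"
proof -
  define I where "I U = {\<sigma>. \<sigma> \<in> independent_sets (hex_cylinder m n) \<and>
      {m + 1} \<times> uncovered n (Suc m) U \<subseteq> \<sigma>}" for U
  have fin: "finite (independent_sets (hex_cylinder m n))"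
    by (rule finite_independent_sets) (simp add: hex_cylinder_def hex_cylinder_verts_def)
  have finI: "finite (I U)" for U using fin by (simp add: I_def)
  have finU: "finite {U. S \<subseteq> U \<and> U \<subseteq> rungs n (Suc m)}" using finite_rungs[of n "Suc m"] by auto
  have "top_sum n (Suc m) S = (\<Sum>(U, \<sigma>)\<in>(SIGMA U:{U. S \<subseteq> U \<and> U \<subseteq> rungs n (Suc m)}. I U).
      (-1) ^ card U * (-1) ^ card \<sigma>)"
    unfolding top_sum_dominating[OF S]
  proof (rule sum.reindex_bij_witness[where i = "\<lambda>(U, \<sigma>). \<sigma> \<union> {m + 2} \<times> U"
        and j = "\<lambda>\<sigma>. ({j. (m + 2, j) \<in> \<sigma>}, {v \<in> \<sigma>. fst v \<le> m + 1})"], goal_cases)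
    case (1 \<sigma>)
    then have "\<sigma> \<in> independent_sets (hex_cylinder (Suc m) n)" by simp
    then have "\<sigma> \<subseteq> {1..m+2} \<times> {1..2*n}"
      using independent_sets_hex_cylinder_subset[of \<sigma> "Suc m" n] by simp
    then show ?case by (auto simp: not_le le_Suc_eq) 
  next
    case (2 \<sigma>)
    then have ind: "\<sigma> \<in> independent_sets (hex_cylinder (Suc m) n)"
      and S': "{m + 2} \<times> S \<subseteq> \<sigma>"
      and B: "\<sigma> \<inter> {m + 2} \<times> rungs n (m + 2) = {}"
      and dom: "\<And>j. j \<in> rungs n (m + 2) \<Longrightarrow>
          \<exists>u\<in>\<sigma>. (u, (m + 2, j)) \<in> parcs (hex_cylinder (Suc m) n)"
      by auto
    from ind have sub: "\<sigma> \<subseteq> {1..m+2} \<times> {1..2*n}"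
      using independent_sets_hex_cylinder_subset[of \<sigma> "Suc m" n] by simp
    define U where "U = {j. (m + 2, j) \<in> \<sigma>}"
    define \<sigma>' where "\<sigma>' = {v \<in> \<sigma>. fst v \<le> m + 1}"
    have "S \<subseteq> U" using S' by (auto simp: U_def)
    moreover have "U \<subseteq> rungs n (Suc m)"
      using sub B by (fastforce simp: U_def rungs_def)
    moreover have "\<sigma>' \<in> independent_sets (hex_cylinder m n)"
      using ind by (auto simp: \<sigma>'_def independent_sets_def hex_cylinder_def hex_cylinder_verts_def)
    moreover have "(m + 1, j) \<in> \<sigma>'" if j: "j \<in> uncovered n (Suc m) U" for j
    proof -
      have "j \<in> rungs n (m + 2)" using j by (simp add: uncovered_def)
      from dom[OF this] obtain i k
        where u: "(i, k) \<in> \<sigma>" "((i, k), (m + 2, j)) \<in> parcs (hex_cylinder (Suc m) n)" by auto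
      have "\<not> hex_row_adj n (i, k) (m + 2, j)"
      proof
        assume adj: "hex_row_adj n (i, k) (m + 2, j)"
        then have "i = m + 2" by (simp add: hex_row_adj_def)
        then show False
          using adj j u(1) hex_row_adj_shift[of n "m + 2" k j] by (simp add: uncovered_def U_def)
      qed
      then have "(i, k) = (m + 1, j)"
        using u sub by (auto simp: hex_cylinder_def hex_vertical_def)
      then show ?thesis using u(1) by (simp add: \<sigma>'_def)
    qed
    ultimately show ?case unfolding U_def[symmetric] \<sigma>'_def[symmetric] by (auto simp: I_def)
  next
    case (3 p)
    then obtain U \<sigma> where p: "p = (U, \<sigma>)" and "\<sigma> \<in> independent_sets (hex_cylinder m n)"
      by (auto simp: I_def)
    then have "\<sigma> \<subseteq> {1..m + 1} \<times> {1..2 * n}" by (intro independent_sets_hex_cylinder_subset)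
    then show ?case unfolding p by fastforce
  next
    case (4 p)
    then obtain U \<sigma> where p: "p = (U, \<sigma>)" and U: "S \<subseteq> U" "U \<subseteq> rungs n (Suc m)"
      and ind: "\<sigma> \<in> independent_sets (hex_cylinder m n)"
      and I: "{m + 1} \<times> uncovered n (Suc m) U \<subseteq> \<sigma>" 
      by (auto simp: I_def)
    define \<tau> where "\<tau> = \<sigma> \<union> {m + 2} \<times> U"
    have sub: "\<sigma> \<subseteq> {1..m+1} \<times> {1..2*n}"
      using ind by (rule independent_sets_hex_cylinder_subset)
    \<comment> \<open>an upward vertex of the top row has no neighbour among the chosen vertices\<close>
    have new: "(v, (m + 2, j)) \<notin> parcs (hex_cylinder (Suc m) n)"
      if v: "v \<in> \<tau>" and j: "j \<in> U" for v j
    proof -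
      obtain i k where [simp]: "v = (i, k)" by (cases v)
      have "even (m + 1 + j)" using j U by (auto simp: rungs_def)
      moreover have "even (m + 1 + k)" if "i = m + 2"
        using v U that sub by (auto simp: \<tau>_def rungs_def)
      then have "\<not> hex_row_adj n v (m + 2, j)"
        using hex_row_adj_opposite_parity[of n i k "m + 2" j] \<open>even (m + 1 + j)\<close>
        by (auto simp: hex_row_adj_def)
      moreover have "i \<le> m + 2" using v sub by (auto simp: \<tau>_def)
      ultimately show ?thesis by (auto simp: hex_cylinder_def hex_vertical_def)
    qed
    have "(u, v) \<notin> parcs (hex_cylinder (Suc m) n)" if uv: "u \<in> \<tau>" "v \<in> \<tau>" for u v
    proof -
      consider "u \<in> {m + 2} \<times> U" | "v \<in> {m + 2} \<times> U" | "u \<in> \<sigma>" "v \<in> \<sigma>"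
        using uv unfolding \<tau>_def by blast
      then show ?thesis
      proof cases
        case 1
        then obtain j where "j \<in> U" "u = (m + 2, j)" by auto
        then have "(v, u) \<notin> parcs (hex_cylinder (Suc m) n)" using new uv by blast
        then show ?thesis
          using parcs_symmetric[OF pair_graph_hex_cylinder] by blast
      next
        case 2
        then obtain j where "j \<in> U" "v = (m + 2, j)" by auto
        then show ?thesis using new uv by blast
      next
        case 3
        then show ?thesis using ind sub
          by (auto simp: independent_sets_def hex_cylinder_def hex_cylinder_verts_def)
      qed
    qed
    moreover have "\<tau> \<subseteq> pverts (hex_cylinder (Suc m) n)"
      using sub U by (auto simp: \<tau>_def rungs_def hex_cylinder_def hex_cylinder_verts_def)
    ultimately have "\<tau> \<in> independent_sets (hex_cylinder (Suc m) n)"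
      by (auto simp: independent_sets_def)
    moreover have "\<exists>u\<in>\<tau>. (u, (m + 2, j)) \<in> parcs (hex_cylinder (Suc m) n)"
      if j: "j \<in> rungs n (m + 2)" for j
    proof (cases "j \<in> uncovered n (Suc m) U")
      case True
      then have "(m + 1, j) \<in> \<tau>" using I by (auto simp: \<tau>_def)
      moreover have "((m + 1, j), (m + 2, j)) \<in> parcs (hex_cylinder (Suc m) n)"
        using j by (simp add: rungs_def hex_cylinder_def hex_cylinder_verts_def hex_vertical_def)
      ultimately show ?thesis by blast
    next
      case False
      then obtain u where u: "u \<in> U" "hex_row_adj n (0, u) (0, j)"
        using j by (auto simp: uncovered_def)
      then have "(m + 2, u) \<in> \<tau>" by (auto simp: \<tau>_def)
      moreover have "((m + 2, u), (m + 2, j)) \<in> parcs (hex_cylinder (Suc m) n)"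
        using j u U hex_row_adj_shift[of n "m + 2" u j]
        by (auto simp: rungs_def hex_cylinder_def hex_cylinder_verts_def)
      ultimately show ?thesis by blast
    qed
    moreover have "\<tau> \<inter> {m + 2} \<times> rungs n (m + 2) = {}"
      using sub U by (auto simp: \<tau>_def rungs_def)
    ultimately show ?case using U unfolding p by (auto simp: \<tau>_def[symmetric]) (auto simp: \<tau>_def)
  next
    case (5 \<sigma>)
    then have "\<sigma> \<in> independent_sets (hex_cylinder (Suc m) n)" by simp
    then have sub: "\<sigma> \<subseteq> {1..m+2} \<times> {1..2*n}"
      using independent_sets_hex_cylinder_subset[of \<sigma> "Suc m" n] by simp
    then have fin: "finite \<sigma>" by (rule finite_subset) simp
    define A where "A = {v \<in> \<sigma>. fst v \<le> m + 1}"
    define C where "C = Pair (m + 2) ` {j. (m + 2, j) \<in> \<sigma>}"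
    have "A \<union> C = \<sigma>" using sub by (force simp: A_def C_def not_le le_Suc_eq)
    moreover from this have "finite A" "finite C" using fin by auto
    moreover have "A \<inter> C = {}" by (auto simp: A_def C_def)
    ultimately have "card \<sigma> = card A + card C" using card_Un_disjoint by metis
    also have "card C = card {j. (m + 2, j) \<in> \<sigma>}"
      unfolding C_def by (intro card_image) (auto simp: inj_on_def)
    finally show ?case by (simp add: A_def power_add mult.commute)
  qed
  also have "\<dots> = transfer n (Suc m) (top_sum n m) S"
    using finU finI by (simp add: sum.Sigma[symmetric] sum_distrib_left transfer_def top_sum_def I_def)
  finally show ?thesis .
qed


section \<open>Rows of four hexagons\<close>

lemma rungs_4: "rungs 4 m = (if even m then {2, 4, 6, 8} else {1, 3, 5, 7})"
proof -
  have "{1..2 * 4} = {1, 2, 3, 4, 5, 6, 7, 8 :: nat}" by auto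
  then show ?thesis unfolding rungs_def by auto
qed

text \<open>Wrapping around the cycle is a jump by 7. The truncated differences \<open>u - 1\<close> and \<open>u - 7\<close> do no harm:
  when they should be nonpositive they are 0, which is not a column. Phrased with a finite set of
  neighbours, the uncovered columns become an explicit set difference.\<close>

lemma hex_row_adj_4:
  assumes "u \<in> {1..8}" "j \<in> {1..8}"
  shows "hex_row_adj 4 (i, u) (i, j) \<longleftrightarrow> j \<in> {u - 1, u + 1, u - 7, u + 7}"
proof -
  have "8 dvd int u - int j - 1 \<longleftrightarrow> u = j + 1 \<or> j = u + 7"
    "8 dvd int u - int j - - 1 \<longleftrightarrow> j = u + 1 \<or> u = j + 7"
    using assms unfolding atLeastAtMost_iff by presburger+
  moreover have "int (2 * 4) = 8" by simp
  ultimately have "hex_row_adj 4 (i, u) (i, j) \<longleftrightarrow> u = j + 1 \<or> j = u + 7 \<or> j = u + 1 \<or> u = j + 7"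
    unfolding hex_row_adj_def prod.case cong_iff_dvd_diff by auto
  then show ?thesis using assms by auto
qed

lemma uncovered_4:
  assumes U: "U \<subseteq> rungs 4 m"
  shows "uncovered 4 m U = rungs 4 (m + 1) - (\<Union>u\<in>U. {u - 1, u + 1, u - 7, u + 7})"
proof -
  have "hex_row_adj 4 (0, u) (0, j) \<longleftrightarrow> j \<in> {u - 1, u + 1, u - 7, u + 7}"
    if "u \<in> U" "j \<in> rungs 4 (m + 1)" for u j
    using that U by (intro hex_row_adj_4) (auto simp: rungs_def)
  then show ?thesis unfolding uncovered_def by blast
qed

text \<open>Used as a rewrite rule, this expands a sum over the subsets of an explicit finite set.\<close>

lemma sum_Pow_insert:
  assumes "finite A" "a \<notin> A"
  shows "sum f (Pow (insert a A)) = sum f (Pow A) + (\<Sum>U\<in>Pow A. f (insert a U))"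
proof -
  have "inj_on (insert a) (Pow A)" using assms(2) by (auto simp: inj_on_def)
  then show ?thesis unfolding Pow_insert using assms
    by (subst sum.union_disjoint) (auto simp: sum.reindex)
qed

lemma transfer_4: "transfer 4 m h S = (\<Sum>U\<in>Pow (rungs 4 m). if S \<subseteq> U then (-1) ^ card U * h (rungs 4 (m + 1) - (\<Union>u\<in>U. {u - 1, u + 1, u - 7, u + 7})) else 0)"
proof -
  have "transfer 4 m h S = (\<Sum>U\<in>{U \<in> Pow (rungs 4 m). S \<subseteq> U}. (-1) ^ card U * h (uncovered 4 m U))"
    unfolding transfer_def by (rule sum.cong) auto
  also have "\<dots> = (\<Sum>U\<in>Pow (rungs 4 m). if S \<subseteq> U then (-1) ^ card U * h (uncovered 4 m U) else 0)"
    by (rule sum.inter_filter) (simp add: rungs_def)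
  also have "\<dots> = (\<Sum>U\<in>Pow (rungs 4 m). if S \<subseteq> U then (-1) ^ card U * h (rungs 4 (m + 1) - (\<Union>u\<in>U. {u - 1, u + 1, u - 7, u + 7})) else 0)"
    by (intro sum.cong) (simp_all only: Pow_iff uncovered_4)
  finally show ?thesis .
qed


text \<open>The columns of \<open>rungs 4 m\<close> have distance 2 along a cycle of length 8, so \<open>y = x + 2\<close> and
  \<open>y = x + 6\<close> are the ways for \<open>x < y\<close> to be cyclically consecutive. Opposite pairs and triples are left
  out: they never occur as uncovered sets.\<close>

definition profile :: "nat \<Rightarrow> int \<Rightarrow> int \<Rightarrow> int \<Rightarrow> (nat set \<Rightarrow> int) \<Rightarrow> bool" where
  "profile m e c q h \<longleftrightarrow> h {} = e \<and> h (rungs 4 m) = q \<and> (\<forall>x\<in>rungs 4 m. h {x} = c) \<and>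
    (\<forall>x\<in>rungs 4 m. \<forall>y\<in>rungs 4 m. y = x + 2 \<or> y = x + 6 \<longrightarrow> h {x, y} = c)"

lemma profile_cong:
  assumes "\<And>S. S \<subseteq> rungs 4 m \<Longrightarrow> h S = h' S" "profile m e c q h'"
  shows "profile m e c q h"
  using assms unfolding profile_def by simp

text \<open>Passing from columns \<open>U\<close> to their uncovered columns sends the full set to the empty one, consecutive
  pairs to singletons, singletons to consecutive pairs, the empty set to the full set and every other set
  to the empty one. Each sum therefore involves \<open>h\<close> only at sets that the profile determines. Demanding
  the same \<open>c\<close> on singletons and on consecutive pairs makes their contributions cancel in the sum over all
  \<open>U\<close>, so that \<open>c\<close> does not enter the new value at the empty set.\<close>

lemma profile_transfer:
  assumes "profile (m + 1) e c q h"
  shows "profile m (q - e) (c - e) e (transfer 4 m h)"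
proof -
  have e: "h {} = e" and q: "h (rungs 4 (m + 1)) = q"
    and c: "\<And>x. x \<in> rungs 4 (m + 1) \<Longrightarrow> h {x} = c"
    and p: "\<And>x y. x \<in> rungs 4 (m + 1) \<Longrightarrow> y \<in> rungs 4 (m + 1) \<Longrightarrow> y = x + 2 \<or> y = x + 6 \<Longrightarrow> h {x, y} = c"
    using assms unfolding profile_def by blast+
  show ?thesis
  proof (cases "even m")
    case True
    then have r: "rungs 4 (m + 1) = {1, 3, 5, 7}" by (simp add: rungs_4)
    have h: "h {1, 3, 5, 7} = q" "h {1} = c" "h {3} = c" "h {5} = c" "h {7} = c"
      "h {1, 3} = c" "h {3, 5} = c" "h {5, 7} = c" "h {1, 7} = c"
      using q c p unfolding r by simp_all
    show ?thesis
      using True unfolding profile_def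
      by (simp add: transfer_4 rungs_4 sum_Pow_insert insert_Diff_if e h del: One_nat_def)
  next
    case False
    then have r: "rungs 4 (m + 1) = {2, 4, 6, 8}" by (simp add: rungs_4)
    have h: "h {2, 4, 6, 8} = q" "h {2} = c" "h {4} = c" "h {6} = c" "h {8} = c"
      "h {2, 4} = c" "h {4, 6} = c" "h {6, 8} = c" "h {2, 8} = c"
      using q c p unfolding r by simp_all
    show ?thesis
      using False unfolding profile_def
      by (simp add: transfer_4 rungs_4 sum_Pow_insert insert_Diff_if e h del: One_nat_def)
  qed
qed

text \<open>The value \<open>c\<close> is left unspecified since the recursion for the other two values does not involve
  it.\<close>

lemma profile_top_sum:
  "\<exists>c. profile m ((-1) ^ (m + 1) * int (fib (m + 2))) c ((-1) ^ m * int (fib (m + 1))) (top_sum 4 m)"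
proof (induction m)
  case 0
  \<comment> \<open>the fictitious row below the first one: 1 on the empty set, 0 on all others\<close>
  have "profile (0 + 1) 1 0 0 (\<lambda>V. of_bool (V = {}))"
    by (auto simp: profile_def rungs_4)
  from profile_transfer[OF this] have "profile 0 (-1) (-1) 1 (top_sum 4 0)"
    by (intro profile_cong[OF top_sum_0]) simp_all
  then show ?case by (auto simp: numeral_2_eq_2)
next
  case (Suc m)
  define e where "e = (-1) ^ (m + 1) * int (fib (m + 2))"
  define q where "q = (-1) ^ m * int (fib (m + 1))"
  obtain c where "profile m e c q (top_sum 4 m)" using Suc.IH by (auto simp: e_def q_def)
  \<comment> \<open>\<open>rungs\<close> has period 2 in the row, so the profile can be read two rows higher\<close>
  then have "profile (Suc m + 1) e c q (top_sum 4 m)" by (simp add: profile_def rungs_Suc_Suc)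
  from profile_transfer[OF this] have "profile (Suc m) (q - e) (c - e) e (top_sum 4 (Suc m))"
    by (intro profile_cong[OF top_sum_Suc]) simp_all
  moreover have "q - e = (-1) ^ (Suc m + 1) * int (fib (Suc m + 2))"
    by (simp add: e_def q_def algebra_simps)
  moreover have "e = (-1) ^ Suc m * int (fib (Suc m + 1))"
    by (simp add: e_def)
  ultimately show ?case by metis
qed

theorem proposition3p7:
  fixes m :: nat
  assumes "m \<ge> 1"
  shows "Z (hex_cylinder m 4) = (-1) ^ (m + 1) * int (fib (m + 2))"
proof -
  have "Z (hex_cylinder m 4) = top_sum 4 m {}" by (simp add: Z_def top_sum_def)
  then show ?thesis using profile_top_sum[of m] by (auto simp: profile_def)
qed

end
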